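(* Let $(W,S)$ be a Coxeter system of type $\Lambda$ and let $\alpha$ and $\beta$ be two braid equivalent reduced expressions of dimension at least one. If $b_1^{j_1},b_2^{j_2},\dots,b_k^{j_k}$ and $b_1^{l_1},b_2^{l_2},\dots,b_k^{l_k}$ are minimal braid sequences from $\alpha$ to $\beta$, then $\{j_1,\dots,j_k\}=\{l_1,\dots,l_k\}$.
   Context: A Coxeter system $(W,S)$ consists of a finite set $S$ and the group $W=\langle S\mid (st)^{m(s,t)}=e\rangle$, where $m(s,s)=1$ and $m(s,t)=m(t,s)\in\{2,3,\dots\}\cup\{\infty\}$ for $s\neq t$ ($m(s,t)=\infty$ means no relation). Its Coxeter graph has vertex set $S$ and an edge $\{s,t\}$ whenever $m(s,t)\ge 3$. $(W,S)$ is of type $\Lambda$ if $m(s,t)\le 3$ for all $s,t\in S$ (simply laced) and the Coxeter graph contains no three-cycles (triangle free). A reduced expression for $w\in W$ is a word over $S$ of minimal length representing $w$. A braid move replaces three consecutive letters $sts$ by $tst$, where $m(s,t)=3$. Two reduced expressions are braid equivalent if they are related by a finite sequence of braid moves; $[\alpha]$ denotes the braid class (equivalence class) of $\alpha$. A braid shadow for a reduced expression $\alpha$ is a set of positions $\{i-1,i,i+1\}$ such that the letters of $\alpha$ in these positions form $sts$ with $m(s,t)=3$. $\mathcal{S}(\alpha)$ is the set of braid shadows for $\alpha$, and $\mathcal{S}([\alpha])=\bigcup_{\beta\in[\alpha]}\mathcal{S}(\beta)$. The dimension of $\alpha$ is $\dim(\alpha)=|\mathcal{S}([\alpha])|$,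 and the braid shadows in $\mathcal{S}([\alpha])$ are numbered $1,\dots,\dim(\alpha)$ from left to right. A braid sequence $b_1^{j_1},\dots,b_k^{j_k}$ from $\alpha$ to $\beta$ is a sequence of braid moves which, applied successively starting at $\alpha$, yields $\beta$, where the $i$th move $b_i^{j_i}$ is the braid move performed in the $j_i$th braid shadow of $\mathcal{S}([\alpha])$. It is minimal if no braid sequence from $\alpha$ to $\beta$ has fewer moves. *)

theory Defs
  imports "HOL-Algebra.Group" "HOL-Library.Extended_Nat"
begin

text \<open>A letter \<open>(x, False)\<close> stands for the generator \<open>x\<close>, a letter \<open>(x, True)\<close> for its formal inverse.\<close>

type_synonym 'a signed_word = "('a \<times> bool) list"

definition signed_words :: "'a set \<Rightarrow> 'a signed_word set" where
  "signed_words X = lists (X \<times> UNIV)"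

inductive pres_eq :: "'a set \<Rightarrow> 'a signed_word set \<Rightarrow> 'a signed_word \<Rightarrow> 'a signed_word \<Rightarrow> bool"
  for X R where
  refl: "u \<in> signed_words X \<Longrightarrow> pres_eq X R u u"
| sym: "pres_eq X R u v \<Longrightarrow> pres_eq X R v u"
| trans: "pres_eq X R u v \<Longrightarrow> pres_eq X R v w \<Longrightarrow> pres_eq X R u w"
| append: "pres_eq X R u u' \<Longrightarrow> pres_eq X R v v' \<Longrightarrow> pres_eq X R (u @ v) (u' @ v')"
| cancel: "x \<in> X \<Longrightarrow> pres_eq X R [(x, b), (x, \<not> b)] []"
| relator: "r \<in> R \<Longrightarrow> r \<in> signed_words X \<Longrightarrow> pres_eq X R r []"

definition pres_class :: "'a set \<Rightarrow> 'a signed_word set \<Rightarrow> 'a signed_word \<Rightarrow> 'a signed_word set" where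
  "pres_class X R u = {v. pres_eq X R u v}"

definition presented_group :: "'a set \<Rightarrow> 'a signed_word set \<Rightarrow> 'a signed_word set monoid" where
  "presented_group X R =
    \<lparr> carrier = pres_class X R ` signed_words X,
      monoid.mult = (\<lambda>A B. {w. \<exists>a\<in>A. \<exists>b\<in>B. pres_eq X R (a @ b) w}),
      one = pres_class X R [] \<rparr>"

lemma pres_eq_signed_words:
  "pres_eq X R u v \<Longrightarrow> u \<in> signed_words X \<and> v \<in> signed_words X"
  by (induction rule: pres_eq.induct) (auto simp: signed_words_def)

lemma pres_class_eq_iff:
  assumes "u \<in> signed_words X"
  shows "pres_class X R u = pres_class X R v \<longleftrightarrow> pres_eq X R u v"
  using assms unfolding pres_class_def by (blast intro: pres_eq.intros)

lemma pres_class_mult: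
  assumes "u \<in> signed_words X" "v \<in> signed_words X"
  shows "pres_class X R u \<otimes>\<^bsub>presented_group X R\<^esub> pres_class X R v = pres_class X R (u @ v)"
  using assms unfolding presented_group_def pres_class_def
  by (auto intro: pres_eq.intros)

lemma pres_eq_inverse:
  assumes "u \<in> signed_words X"
  shows "pres_eq X R (rev (map (\<lambda>(x, b). (x, \<not> b)) u) @ u) []"
  using assms
proof (induction u)
  case Nil
  then show ?case by (auto intro: pres_eq.refl)
next
  case (Cons a u)
  obtain x b where a: "a = (x, b)" by (cases a)
  let ?i = "rev (map (\<lambda>(x, b). (x, \<not> b)) u)"
  have x: "x \<in> X" and u: "u \<in> signed_words X"
    using Cons.prems a by (auto simp: signed_words_def)
  have i: "?i \<in> signed_words X"
    using u by (auto simp: signed_words_def)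
  have "pres_eq X R [(x, \<not> b), (x, b)] []"
    using pres_eq.cancel[OF x, of R "\<not> b"] by simp
  then have "pres_eq X R (?i @ [(x, \<not> b), (x, b)] @ u) (?i @ [] @ u)"
    by (intro pres_eq.append pres_eq.refl i u)
  with Cons.IH[OF u] show ?case
    by (auto simp: a intro: pres_eq.trans)
qed

lemma group_presented_group: "group (presented_group X R)"
proof (rule groupI)
  let ?G = "presented_group X R"
  have c: "carrier ?G = pres_class X R ` signed_words X"
    and o: "\<one>\<^bsub>?G\<^esub> = pres_class X R []"
    by (auto simp: presented_group_def)
  have app: "u @ v \<in> signed_words X" if "u \<in> signed_words X" "v \<in> signed_words X" for u v :: "'a signed_word"
    using that by (auto simp: signed_words_def)
  have nil: "[] \<in> signed_words X"
    by (auto simp: signed_words_def)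
  show "\<one>\<^bsub>?G\<^esub> \<in> carrier ?G"
    unfolding c o using nil by blast
  show "x \<otimes>\<^bsub>?G\<^esub> y \<in> carrier ?G" if "x \<in> carrier ?G" "y \<in> carrier ?G" for x y
    using that app unfolding c by (auto simp: pres_class_mult)
  show "x \<otimes>\<^bsub>?G\<^esub> y \<otimes>\<^bsub>?G\<^esub> z = x \<otimes>\<^bsub>?G\<^esub> (y \<otimes>\<^bsub>?G\<^esub> z)"
    if "x \<in> carrier ?G" "y \<in> carrier ?G" "z \<in> carrier ?G" for x y z
    using that app unfolding c by (auto simp: pres_class_mult)
  show "\<one>\<^bsub>?G\<^esub> \<otimes>\<^bsub>?G\<^esub> x = x" if "x \<in> carrier ?G" for x
    using that nil unfolding c o by (auto simp: pres_class_mult)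
  show "\<exists>y\<in>carrier ?G. y \<otimes>\<^bsub>?G\<^esub> x = \<one>\<^bsub>?G\<^esub>" if x: "x \<in> carrier ?G" for x
  proof -
    obtain u where u: "u \<in> signed_words X" "x = pres_class X R u"
      using x unfolding c by blast
    let ?i = "rev (map (\<lambda>(x, b). (x, \<not> b)) u)"
    have i: "?i \<in> signed_words X"
      using u by (auto simp: signed_words_def)
    have "pres_class X R ?i \<otimes>\<^bsub>?G\<^esub> x = \<one>\<^bsub>?G\<^esub>"
      using pres_eq_inverse[OF u(1), of R] app[OF i u(1)]
      by (simp add: u(2) pres_class_mult[OF i u(1)] o pres_class_eq_iff)
    then show ?thesis
      using i unfolding c by blast
  qed
qed

text \<open>A Coxeter system is given by its generating set \<open>S\<close> and its matrix \<open>m\<close>; only the values of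
  \<open>m\<close> on \<open>S\<close> matter.\<close>

definition coxeter_system :: "'a set \<Rightarrow> ('a \<Rightarrow> 'a \<Rightarrow> enat) \<Rightarrow> bool" where
  "coxeter_system S m \<longleftrightarrow> finite S \<and> (\<forall>s\<in>S. m s s = 1) \<and>
     (\<forall>s\<in>S. \<forall>t\<in>S. s \<noteq> t \<longrightarrow> m s t = m t s \<and> 2 \<le> m s t)"

definition coxeter_relators :: "'a set \<Rightarrow> ('a \<Rightarrow> 'a \<Rightarrow> enat) \<Rightarrow> 'a signed_word set" where
  "coxeter_relators S m =
     {concat (replicate k [(s, False), (t, False)]) | s t k. s \<in> S \<and> t \<in> S \<and> m s t = enat k}"

definition coxeter_group :: "'a set \<Rightarrow> ('a \<Rightarrow> 'a \<Rightarrow> enat) \<Rightarrow> 'a signed_word set monoid" where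
  "coxeter_group S m = presented_group S (coxeter_relators S m)"

definition coxeter_gen :: "'a set \<Rightarrow> ('a \<Rightarrow> 'a \<Rightarrow> enat) \<Rightarrow> 'a \<Rightarrow> 'a signed_word set" where
  "coxeter_gen S m s = pres_class S (coxeter_relators S m) [(s, False)]"

definition coxeter_edge :: "'a set \<Rightarrow> ('a \<Rightarrow> 'a \<Rightarrow> enat) \<Rightarrow> 'a \<Rightarrow> 'a \<Rightarrow> bool" where
  "coxeter_edge S m s t \<longleftrightarrow> s \<in> S \<and> t \<in> S \<and> s \<noteq> t \<and> 3 \<le> m s t"

definition type_Lambda :: "'a set \<Rightarrow> ('a \<Rightarrow> 'a \<Rightarrow> enat) \<Rightarrow> bool" where
  "type_Lambda S m \<longleftrightarrow> (\<forall>s\<in>S. \<forall>t\<in>S. m s t \<le> 3) \<and>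
     \<not> (\<exists>s t u. coxeter_edge S m s t \<and> coxeter_edge S m t u \<and> coxeter_edge S m u s)"

definition word_value :: "'a set \<Rightarrow> ('a \<Rightarrow> 'a \<Rightarrow> enat) \<Rightarrow> 'a list \<Rightarrow> 'a signed_word set" where
  "word_value S m \<alpha> =
     foldr (\<lambda>s g. coxeter_gen S m s \<otimes>\<^bsub>coxeter_group S m\<^esub> g) \<alpha> \<one>\<^bsub>coxeter_group S m\<^esub>"

definition reduced_expression :: "'a set \<Rightarrow> ('a \<Rightarrow> 'a \<Rightarrow> enat) \<Rightarrow> 'a list \<Rightarrow> bool" where
  "reduced_expression S m \<alpha> \<longleftrightarrow> \<alpha> \<in> lists S \<and>
     (\<forall>\<beta>\<in>lists S. word_value S m \<beta> = word_value S m \<alpha> \<longrightarrow> length \<alpha> \<le> length \<beta>)"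

lemma word_value_eq_pres_class:
  assumes "\<alpha> \<in> lists S"
  shows "word_value S m \<alpha> = pres_class S (coxeter_relators S m) (map (\<lambda>s. (s, False)) \<alpha>)"
  using assms
proof (induction \<alpha>)
  case Nil
  then show ?case by (simp add: word_value_def coxeter_group_def presented_group_def)
next
  case (Cons s \<alpha>)
  then have w: "[(s, False)] \<in> signed_words S" "map (\<lambda>s. (s, False)) \<alpha> \<in> signed_words S"
    by (auto simp: signed_words_def)
  have "word_value S m (s # \<alpha>) = coxeter_gen S m s \<otimes>\<^bsub>coxeter_group S m\<^esub> word_value S m \<alpha>"
    by (simp add: word_value_def)
  with Cons pres_class_mult[OF w] show ?case
    by (simp add: coxeter_gen_def coxeter_group_def)
qed

text \<open>Positions in a word are counted from 0, as for \<open>(!)\<close>.\<close>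

definition braid_shadows :: "('a \<Rightarrow> 'a \<Rightarrow> enat) \<Rightarrow> 'a list \<Rightarrow> nat set set" where
  "braid_shadows m \<alpha> =
     {{i, i + 1, i + 2} | i. i + 2 < length \<alpha> \<and> \<alpha> ! i = \<alpha> ! (i + 2) \<and> m (\<alpha> ! i) (\<alpha> ! (i + 1)) = 3}"

definition braid_move_at :: "('a \<Rightarrow> 'a \<Rightarrow> enat) \<Rightarrow> nat set \<Rightarrow> 'a list \<Rightarrow> 'a list \<Rightarrow> bool" where
  "braid_move_at m P \<alpha> \<beta> \<longleftrightarrow>
     (\<exists>u v s t. m s t = 3 \<and> \<alpha> = u @ [s, t, s] @ v \<and> \<beta> = u @ [t, s, t] @ v \<and>
        P = {length u, length u + 1, length u + 2})"

definition braid_move :: "('a \<Rightarrow> 'a \<Rightarrow> enat) \<Rightarrow> 'a list \<Rightarrow> 'a list \<Rightarrow> bool" where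
  "braid_move m \<alpha> \<beta> \<longleftrightarrow> (\<exists>P. braid_move_at m P \<alpha> \<beta>)"

definition braid_equivalent :: "('a \<Rightarrow> 'a \<Rightarrow> enat) \<Rightarrow> 'a list \<Rightarrow> 'a list \<Rightarrow> bool" where
  "braid_equivalent m = (braid_move m)\<^sup>*\<^sup>*"

definition braid_class :: "('a \<Rightarrow> 'a \<Rightarrow> enat) \<Rightarrow> 'a list \<Rightarrow> 'a list set" where
  "braid_class m \<alpha> = {\<beta>. braid_equivalent m \<alpha> \<beta>}"

definition class_shadows :: "('a \<Rightarrow> 'a \<Rightarrow> enat) \<Rightarrow> 'a list \<Rightarrow> nat set set" where
  "class_shadows m \<alpha> = (\<Union>\<beta>\<in>braid_class m \<alpha>. braid_shadows m \<beta>)"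

definition braid_dim :: "('a \<Rightarrow> 'a \<Rightarrow> enat) \<Rightarrow> 'a list \<Rightarrow> nat" where
  "braid_dim m \<alpha> = card (class_shadows m \<alpha>)"

text \<open>A shadow is determined by its leftmost position, so counting the shadows that start no further
  right numbers the elements of \<^term>\<open>class_shadows m \<alpha>\<close> by \<open>1, \<dots>, \<close>\<^term>\<open>braid_dim m \<alpha>\<close>
  from left to right.\<close>

definition shadow_number :: "('a \<Rightarrow> 'a \<Rightarrow> enat) \<Rightarrow> 'a list \<Rightarrow> nat set \<Rightarrow> nat" where
  "shadow_number m \<alpha> P = card {Q \<in> class_shadows m \<alpha>. Min Q \<le> Min P}"

text \<open>A braid move is determined by the word it is applied to and by its shadow, so a braid sequence
  \<open>b\<^sub>1, \<dots>, b\<^sub>k\<close> from \<open>\<alpha>\<close> is recorded as the list of the numbers \<open>j\<^sub>1, \<dots>, j\<^sub>k\<close> of its shadows in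
  \<^term>\<open>class_shadows m \<alpha>\<close>. In \<open>braid_path\<close> the class is that of the fixed first word \<open>\<alpha>\<close>,
  while \<open>\<gamma>\<close> is the current word.\<close>

fun braid_path :: "('a \<Rightarrow> 'a \<Rightarrow> enat) \<Rightarrow> 'a list \<Rightarrow> 'a list \<Rightarrow> nat list \<Rightarrow> 'a list \<Rightarrow> bool" where
  "braid_path m \<alpha> \<gamma> [] \<beta> \<longleftrightarrow> \<gamma> = \<beta>"
| "braid_path m \<alpha> \<gamma> (j # js) \<beta> \<longleftrightarrow>
     (\<exists>P \<delta>. P \<in> class_shadows m \<alpha> \<and> shadow_number m \<alpha> P = j \<and> braid_move_at m P \<gamma> \<delta> \<and>
        braid_path m \<alpha> \<delta> js \<beta>)"

definition braid_sequence :: "('a \<Rightarrow> 'a \<Rightarrow> enat) \<Rightarrow> 'a list \<Rightarrow> nat list \<Rightarrow> 'a list \<Rightarrow> bool" where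
  "braid_sequence m \<alpha> js \<beta> \<longleftrightarrow> braid_path m \<alpha> \<alpha> js \<beta>"

definition minimal_braid_sequence :: "('a \<Rightarrow> 'a \<Rightarrow> enat) \<Rightarrow> 'a list \<Rightarrow> nat list \<Rightarrow> 'a list \<Rightarrow> bool" where
  "minimal_braid_sequence m \<alpha> js \<beta> \<longleftrightarrow> braid_sequence m \<alpha> js \<beta> \<and>
     (\<forall>js'. braid_sequence m \<alpha> js' \<beta> \<longrightarrow> length js \<le> length js')"

end

theory Submission
  imports Defs
begin

text \<open>
  Record a braid move by the leftmost position \<open>i\<close> of its shadow \<open>{i, i + 1, i + 2}\<close>. The theorem
  holds because the set of shadows used by a minimal sequence can be read off from its two end
  words: it consists of the shadows of the class at whose centre the two words carry different
  letters (\<open>distinct_walk_set\<close>). Three observations lead there.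

  Two shadows of one class never share exactly two positions (\<open>class_braids_not_adjacent\<close>). A walk of
  braid moves from a word with a shadow at \<open>i\<close> to a word with a shadow at \<open>i + 1\<close>, taken as short as
  possible, can only use shadows lying entirely to the left or entirely to the right of the border
  between the positions \<open>i + 2\<close> and \<open>i + 3\<close>, and it leaves the positions \<open>i + 1\<close> and \<open>i + 2\<close> alone.
  Performing only the moves on the right turns the first word into one that contains \<open>stst\<close>, which
  is not reduced. Consequently the letter at the centre of a shadow is changed only by the moves in
  that very shadow.

  A walk that uses some shadow twice can be shortened (\<open>repeated_braid_shortens\<close>). Take two uses of
  the shadow \<open>i\<close> between which no shadow is used twice. If a shadow sharing an end position with \<open>i\<close>
  were used in between, it would be used once, and would replace the letter \<open>t\<close> at that position by
  a letter \<open>u\<close> with \<open>m(t,u) = 3\<close>, while the centre keeps its letter \<open>s\<close>. The second move at \<open>i\<close> then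
  needs \<open>m(u,s) = 3\<close>, and \<open>s\<close>, \<open>t\<close>, \<open>u\<close> form a three-cycle of the Coxeter graph. So nothing in between
  touches the shadow, and the two moves cancel.

  Hence a minimal sequence uses every shadow at most once, and a shadow is used exactly when the
  letter at its centre changes.
\<close>

section \<open>Reduced words\<close>

definition word_equiv :: "'a set \<Rightarrow> ('a \<Rightarrow> 'a \<Rightarrow> enat) \<Rightarrow> 'a list \<Rightarrow> 'a list \<Rightarrow> bool" where
  "word_equiv S m u v \<longleftrightarrow>
     pres_eq S (coxeter_relators S m) (map (\<lambda>s. (s, False)) u) (map (\<lambda>s. (s, False)) v)"

lemma map_positive_signed_words:
  "u \<in> lists S \<Longrightarrow> map (\<lambda>s. (s, False)) u \<in> signed_words S"
  by (auto simp: signed_words_def)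

lemma word_equiv_refl: "u \<in> lists S \<Longrightarrow> word_equiv S m u u"
  unfolding word_equiv_def by (intro pres_eq.refl map_positive_signed_words)

lemma word_equiv_sym: "word_equiv S m u v \<Longrightarrow> word_equiv S m v u"
  unfolding word_equiv_def by (rule pres_eq.sym)

lemma word_equiv_trans [trans]:
  "word_equiv S m u v \<Longrightarrow> word_equiv S m v w \<Longrightarrow> word_equiv S m u w"
  unfolding word_equiv_def by (rule pres_eq.trans)

lemma word_equiv_append:
  "word_equiv S m u u' \<Longrightarrow> word_equiv S m v v' \<Longrightarrow> word_equiv S m (u @ v) (u' @ v')"
  unfolding word_equiv_def by (simp add: pres_eq.append)

lemma word_equiv_context:
  assumes "word_equiv S m x y" "u \<in> lists S" "v \<in> lists S"
  shows "word_equiv S m (u @ x @ v) (u @ y @ v)"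
  using assms by (intro word_equiv_append word_equiv_refl)

lemma word_equiv_value:
  assumes "word_equiv S m u v" "u \<in> lists S" "v \<in> lists S"
  shows "word_value S m u = word_value S m v"
  using assms
  by (simp add: word_equiv_def word_value_eq_pres_class pres_class_eq_iff map_positive_signed_words)

lemma word_equiv_square:
  assumes "coxeter_system S m" "s \<in> S"
  shows "word_equiv S m [s, s] []"
proof -
  have "m s s = enat 1" using assms by (simp add: coxeter_system_def one_enat_def)
  then have "concat (replicate 1 [(s, False), (s, False)]) \<in> coxeter_relators S m"
    using assms unfolding coxeter_relators_def by blast
  then show ?thesis
    unfolding word_equiv_def using assms(2) by (auto intro: pres_eq.relator simp: signed_words_def)
qed

lemma word_equiv_braid:
  assumes "coxeter_system S m" "s \<in> S" "t \<in> S" "m s t = 3"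
  shows "word_equiv S m [s, t, s] [t, s, t]"
proof -
  have "m s t = enat 3" using assms by (simp add: numeral_eq_enat)
  then have "concat (replicate 3 [(s, False), (t, False)]) \<in> coxeter_relators S m"
    using assms unfolding coxeter_relators_def by blast
  then have rel: "word_equiv S m [s, t, s, t, s, t] []"
    unfolding word_equiv_def using assms(2,3)
    by (auto intro: pres_eq.relator simp: signed_words_def numeral_3_eq_3)
  have sq: "word_equiv S m (u @ [x, x] @ v) (u @ v)"
    if "x \<in> S" "u \<in> lists S" "v \<in> lists S" for x u v
    using word_equiv_context[OF word_equiv_square[OF assms(1) that(1)] that(2,3)] by simp
  \<comment> \<open>The word \<open>tst\<close> is its own inverse, so \<open>tst \<cdot> tst\<close> may be inserted after \<open>sts\<close>; the
    relator \<open>(st)\<^sup>3\<close> then removes \<open>sts \<cdot> tst\<close>.\<close>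
  have "word_equiv S m ([s, t, s] @ [t, s, t, t, s, t]) ([s, t, s] @ [t, s, s, t])"
    using sq[of t "[s, t, s, t, s]" "[s, t]"] assms by simp
  also have "word_equiv S m \<dots> ([s, t, s] @ [t, t])"
    using sq[of s "[s, t, s, t]" "[t]"] assms by simp
  also have "word_equiv S m \<dots> [s, t, s]"
    using sq[of t "[s, t, s]" "[]"] assms by simp
  finally have "word_equiv S m [s, t, s] ([s, t, s, t, s, t] @ [t, s, t])"
    by (simp add: word_equiv_sym)
  also have "word_equiv S m \<dots> [t, s, t]"
    using word_equiv_context[OF rel, of "[]" "[t, s, t]"] assms by simp
  finally show ?thesis .
qed

text \<open>Here \<open>stst = tst\<cdot>t = ts\<close> shortens the word.\<close>

lemma reduced_no_alternating_four:
  assumes "coxeter_system S m" "reduced_expression S m (u @ [s, t, s, t] @ v)"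
  shows "m s t \<noteq> 3"
proof
  assume m: "m s t = 3"
  have S: "u \<in> lists S" "v \<in> lists S" "s \<in> S" "t \<in> S"
    using assms(2) by (auto simp: reduced_expression_def)
  have "word_equiv S m ([s, t, s] @ [t]) ([t, s, t] @ [t])"
    using word_equiv_context[OF word_equiv_braid[OF assms(1) S(3,4) m], of "[]" "[t]"] S by simp
  also have "word_equiv S m \<dots> [t, s]"
    using word_equiv_context[OF word_equiv_square[OF assms(1) S(4)], of "[t, s]" "[]"] S by simp
  finally have "word_equiv S m (u @ [s, t, s, t] @ v) (u @ [t, s] @ v)"
    using word_equiv_context[of S m "[s, t, s, t]" "[t, s]", OF _ S(1,2)] by simp
  from word_equiv_value[OF word_equiv_sym[OF this]] S
  have "word_value S m (u @ [t, s] @ v) = word_value S m (u @ [s, t, s, t] @ v)" by simp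
  moreover have "u @ [t, s] @ v \<in> lists S" using S by simp
  ultimately have "length (u @ [s, t, s, t] @ v) \<le> length (u @ [t, s] @ v)"
    using assms(2) unfolding reduced_expression_def by blast
  then show False by simp
qed

lemma reduced_expression_transfer:
  assumes "reduced_expression S m u" "word_equiv S m u v" "v \<in> lists S" "length v = length u"
  shows "reduced_expression S m v"
  using assms word_equiv_value[OF assms(2)] unfolding reduced_expression_def by auto

section \<open>Braid moves by position\<close>

definition has_braid :: "('a \<Rightarrow> 'a \<Rightarrow> enat) \<Rightarrow> 'a list \<Rightarrow> nat \<Rightarrow> bool" where
  "has_braid m \<gamma> i \<longleftrightarrow>
     i + 2 < length \<gamma> \<and> \<gamma> ! i = \<gamma> ! (i + 2) \<and> m (\<gamma> ! i) (\<gamma> ! (i + 1)) = 3"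

definition flip_braid :: "nat \<Rightarrow> 'a list \<Rightarrow> 'a list" where
  "flip_braid i \<gamma> = \<gamma>[i := \<gamma> ! (i + 1), i + 1 := \<gamma> ! i, i + 2 := \<gamma> ! (i + 1)]"

fun braid_walk :: "('a \<Rightarrow> 'a \<Rightarrow> enat) \<Rightarrow> 'a list \<Rightarrow> nat list \<Rightarrow> 'a list \<Rightarrow> bool" where
  "braid_walk m \<gamma> [] \<delta> \<longleftrightarrow> \<gamma> = \<delta>"
| "braid_walk m \<gamma> (i # is) \<delta> \<longleftrightarrow> has_braid m \<gamma> i \<and> braid_walk m (flip_braid i \<gamma>) is \<delta>"

lemma has_braid_cong:
  assumes "has_braid m \<gamma> i" "length \<delta> = length \<gamma>"
    and "\<delta> ! i = \<gamma> ! i" "\<delta> ! (i + 1) = \<gamma> ! (i + 1)" "\<delta> ! (i + 2) = \<gamma> ! (i + 2)"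
  shows "has_braid m \<delta> i"
  using assms unfolding has_braid_def by metis

lemma braid_shadows_eq: "braid_shadows m \<gamma> = {{i, i + 1, i + 2} | i. has_braid m \<gamma> i}"
  by (auto simp: braid_shadows_def has_braid_def)

lemma shadow_inject: "{i, i + 1, i + 2} = {j, j + 1, j + 2} \<longleftrightarrow> i = (j::nat)"
proof
  assume eq: "{i, i + 1, i + 2} = {j, j + 1, j + 2}"
  have "Min {k, k + 1, k + 2} = k" for k :: nat by (simp add: min_def)
  with eq show "i = j" by metis
qed simp

lemma length_flip_braid [simp]: "length (flip_braid i \<gamma>) = length \<gamma>"
  by (simp add: flip_braid_def)

lemma nth_flip_braid:
  assumes "i + 2 < length \<gamma>"
  shows "flip_braid i \<gamma> ! k =
    (if k = i \<or> k = i + 2 then \<gamma> ! (i + 1) else if k = i + 1 then \<gamma> ! i else \<gamma> ! k)"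
  using assms by (auto simp: flip_braid_def nth_list_update)

lemma nth_flip_braid_inside:
  assumes "i + 2 < length \<gamma>"
  shows "flip_braid i \<gamma> ! i = \<gamma> ! (i + 1)" "flip_braid i \<gamma> ! Suc i = \<gamma> ! i"
    "flip_braid i \<gamma> ! Suc (Suc i) = \<gamma> ! (i + 1)"
  using assms by (simp_all add: nth_flip_braid)

lemma nth_flip_braid_outside:
  "k \<noteq> i \<Longrightarrow> k \<noteq> i + 1 \<Longrightarrow> k \<noteq> i + 2 \<Longrightarrow> flip_braid i \<gamma> ! k = \<gamma> ! k"
  by (simp add: flip_braid_def)

lemma braid_move_at_iff:
  "braid_move_at m P \<gamma> \<delta> \<longleftrightarrow>
     (\<exists>i. P = {i, i + 1, i + 2} \<and> has_braid m \<gamma> i \<and> \<delta> = flip_braid i \<gamma>)" (is "?L \<longleftrightarrow> ?R")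
proof
  assume ?L
  then obtain u v s t where *: "m s t = 3" "\<gamma> = u @ [s, t, s] @ v" "\<delta> = u @ [t, s, t] @ v"
      "P = {length u, length u + 1, length u + 2}"
    by (auto simp: braid_move_at_def)
  have "has_braid m \<gamma> (length u)" using * by (simp add: has_braid_def nth_append)
  moreover have "\<delta> = flip_braid (length u) \<gamma>"
    using * by (simp add: flip_braid_def nth_append list_update_append)
  ultimately show ?R using * by blast
next
  assume ?R
  then obtain i where *: "P = {i, i + 1, i + 2}" "has_braid m \<gamma> i" "\<delta> = flip_braid i \<gamma>" by blast
  let ?u = "take i \<gamma>" and ?v = "drop (i + 3) \<gamma>" and ?s = "\<gamma> ! i" and ?t = "\<gamma> ! (i + 1)"
  have len: "i + 2 < length \<gamma>" using * by (simp add: has_braid_def)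
  have \<gamma>: "\<gamma> = ?u @ [?s, ?t, \<gamma> ! (i + 2)] @ ?v"
    using len by (simp add: Cons_nth_drop_Suc numeral_3_eq_3 numeral_2_eq_2)
  have lu: "length ?u = i" using len by simp
  have "\<delta> = ?u @ [?t, ?s, ?t] @ ?v"
    unfolding * flip_braid_def
    by (subst (1) \<gamma>) (use lu in \<open>simp add: list_update_append nth_append\<close>)
  then show ?L
    unfolding braid_move_at_def using * \<gamma> lu by (metis has_braid_def)
qed

lemma braid_walk_append:
  "braid_walk m \<gamma> (is @ js) \<delta> \<longleftrightarrow> (\<exists>\<epsilon>. braid_walk m \<gamma> is \<epsilon> \<and> braid_walk m \<epsilon> js \<delta>)"
  by (induction "is" arbitrary: \<gamma>) auto

lemma braid_walk_length: "braid_walk m \<gamma> is \<delta> \<Longrightarrow> length \<delta> = length \<gamma>"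
  by (induction "is" arbitrary: \<gamma>) auto

lemma braid_equivalent_iff_walk: "braid_equivalent m \<gamma> \<delta> \<longleftrightarrow> (\<exists>is. braid_walk m \<gamma> is \<delta>)"
proof
  assume "braid_equivalent m \<gamma> \<delta>"
  then have "(braid_move m)\<^sup>*\<^sup>* \<gamma> \<delta>" by (simp add: braid_equivalent_def)
  then show "\<exists>is. braid_walk m \<gamma> is \<delta>"
  proof (induction rule: converse_rtranclp_induct)
    case base
    have "braid_walk m \<delta> [] \<delta>" by simp
    then show ?case by blast
  next
    case (step \<gamma> \<epsilon>)
    then obtain "is" i where "braid_walk m \<epsilon> is \<delta>" "has_braid m \<gamma> i" "\<epsilon> = flip_braid i \<gamma>"
      by (auto simp: braid_move_def braid_move_at_iff)
    then have "braid_walk m \<gamma> (i # is) \<delta>" by simp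
    then show ?case by blast
  qed
next
  assume "\<exists>is. braid_walk m \<gamma> is \<delta>"
  then obtain "is" where "braid_walk m \<gamma> is \<delta>" by blast
  then show "braid_equivalent m \<gamma> \<delta>"
    unfolding braid_equivalent_def
  proof (induction "is" arbitrary: \<gamma>)
    case (Cons i "is")
    have "braid_move m \<gamma> (flip_braid i \<gamma>)"
      using Cons.prems unfolding braid_move_def braid_move_at_iff by auto
    with Cons show ?case by (auto intro: converse_rtranclp_into_rtranclp)
  qed simp
qed

lemma braid_walk_nth_untouched:
  assumes "braid_walk m \<gamma> is \<delta>" "\<And>i. i \<in> set is \<Longrightarrow> k \<noteq> i \<and> k \<noteq> i + 1 \<and> k \<noteq> i + 2"
  shows "\<delta> ! k = \<gamma> ! k"
  using assms
proof (induction "is" arbitrary: \<gamma>)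
  case (Cons i "is")
  have "i + 2 < length \<gamma>" using Cons.prems by (simp add: has_braid_def)
  then have "flip_braid i \<gamma> ! k = \<gamma> ! k" using Cons.prems(2)[of i] by (simp add: nth_flip_braid)
  with Cons show ?case by auto
qed simp

text \<open>If no move of a walk crosses the border before position \<open>b\<close>, the moves to its right do not
  notice what happens to its left, so they can be performed alone. The induction needs the word on
  the left to be arbitrary, whence the second word \<open>\<gamma>'\<close>.\<close>

lemma braid_walk_right_part:
  assumes "braid_walk m \<gamma> is \<delta>" "\<And>j. j \<in> set is \<Longrightarrow> j + 2 < b \<or> b \<le> j"
    and "length \<gamma>' = length \<gamma>" "\<And>k. b \<le> k \<Longrightarrow> \<gamma>' ! k = \<gamma> ! k"
  shows "\<exists>\<delta>'. braid_walk m \<gamma>' (filter (\<lambda>j. b \<le> j) is) \<delta>' \<and>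
    (\<forall>k<b. \<delta>' ! k = \<gamma>' ! k) \<and> (\<forall>k\<ge>b. \<delta>' ! k = \<delta> ! k)"
  using assms
proof (induction "is" arbitrary: \<gamma> \<gamma>')
  case (Cons j "is")
  have braid: "has_braid m \<gamma> j" and walk: "braid_walk m (flip_braid j \<gamma>) is \<delta>"
    using Cons.prems(1) by auto
  have len: "j + 2 < length \<gamma>" using braid by (simp add: has_braid_def)
  show ?case
  proof (cases "b \<le> j")
    case True
    have "has_braid m \<gamma>' j"
      using True Cons.prems(3,4) by (intro has_braid_cong[OF braid]) auto
    moreover have "\<exists>\<delta>'. braid_walk m (flip_braid j \<gamma>') (filter (\<lambda>j. b \<le> j) is) \<delta>' \<and>
        (\<forall>k<b. \<delta>' ! k = flip_braid j \<gamma>' ! k) \<and> (\<forall>k\<ge>b. \<delta>' ! k = \<delta> ! k)"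
      by (rule Cons.IH[OF walk]) (use Cons.prems True len in \<open>auto simp: nth_flip_braid\<close>)
    moreover have "flip_braid j \<gamma>' ! k = \<gamma>' ! k" if "k < b" for k
      using that True len Cons.prems(3) by (simp add: nth_flip_braid)
    ultimately show ?thesis using True by auto
  next
    case False
    then have "j + 2 < b" using Cons.prems(2)[of j] by auto
    then have "\<exists>\<delta>'. braid_walk m \<gamma>' (filter (\<lambda>j. b \<le> j) is) \<delta>' \<and>
        (\<forall>k<b. \<delta>' ! k = \<gamma>' ! k) \<and> (\<forall>k\<ge>b. \<delta>' ! k = \<delta> ! k)"
      by (intro Cons.IH[OF walk]) (use Cons.prems len in \<open>auto simp: nth_flip_braid\<close>)
    then show ?thesis using False by simp
  qed
qed auto

lemma flip_braid_involution:
  assumes "has_braid m \<gamma> i"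
  shows "flip_braid i (flip_braid i \<gamma>) = \<gamma>"
  using assms by (intro nth_equalityI) (auto simp: has_braid_def nth_flip_braid)

text \<open>A braid move in a shadow that the walk never touches commutes with the whole walk.\<close>

lemma braid_walk_flip_disjoint:
  assumes "braid_walk m \<gamma> is \<delta>" "i + 2 < length \<gamma>"
    and "\<And>j. j \<in> set is \<Longrightarrow> j + 2 < i \<or> i + 2 < j"
  shows "braid_walk m (flip_braid i \<gamma>) is (flip_braid i \<delta>)"
  using assms
proof (induction "is" arbitrary: \<gamma>)
  case (Cons j "is")
  have braid: "has_braid m \<gamma> j" and walk: "braid_walk m (flip_braid j \<gamma>) is \<delta>"
    using Cons.prems(1) by auto
  have len: "j + 2 < length \<gamma>" using braid by (simp add: has_braid_def)
  have far: "j + 2 < i \<or> i + 2 < j" using Cons.prems(3) by auto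
  have "flip_braid i (flip_braid j \<gamma>) = flip_braid j (flip_braid i \<gamma>)"
  proof (rule nth_equalityI)
    fix k
    consider "k = j \<or> k = j + 1 \<or> k = j + 2" | "k = i \<or> k = i + 1 \<or> k = i + 2"
      | "k \<notin> {j, j + 1, j + 2, i, i + 1, i + 2}" by blast
    then show "flip_braid i (flip_braid j \<gamma>) ! k = flip_braid j (flip_braid i \<gamma>) ! k"
      using far len Cons.prems(2)
      by cases (elim disjE insertE; simp add: nth_flip_braid_inside nth_flip_braid_outside)+
  qed simp
  moreover have "has_braid m (flip_braid i \<gamma>) j"
    using far by (intro has_braid_cong[OF braid]) (auto simp: nth_flip_braid_outside)
  moreover have "braid_walk m (flip_braid i (flip_braid j \<gamma>)) is (flip_braid i \<delta>)"
    using Cons.IH[OF walk] Cons.prems by simp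
  ultimately show ?case by simp
qed simp

section \<open>The braid class of a reduced word\<close>

locale reduced_braid_class =
  fixes S :: "'a set" and m :: "'a \<Rightarrow> 'a \<Rightarrow> enat" and \<alpha> :: "'a list"
  assumes coxeter: "coxeter_system S m" and reduced: "reduced_expression S m \<alpha>"
begin

abbreviation "words \<equiv> braid_class m \<alpha>"

lemma weight_sym: "s \<in> S \<Longrightarrow> t \<in> S \<Longrightarrow> m s t = m t s"
  using coxeter by (metis coxeter_system_def)

lemma weight_three_neq: "s \<in> S \<Longrightarrow> m s t = 3 \<Longrightarrow> s \<noteq> t"
  using coxeter by (auto simp: coxeter_system_def)

lemma words_iff: "\<gamma> \<in> words \<longleftrightarrow> (\<exists>is. braid_walk m \<alpha> is \<gamma>)"
  by (simp add: braid_class_def braid_equivalent_iff_walk)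

lemma walk_in_words: "\<gamma> \<in> words \<Longrightarrow> braid_walk m \<gamma> is \<delta> \<Longrightarrow> \<delta> \<in> words"
  unfolding words_iff using braid_walk_append by blast

lemma flip_in_words: "\<gamma> \<in> words \<Longrightarrow> has_braid m \<gamma> i \<Longrightarrow> flip_braid i \<gamma> \<in> words"
  using walk_in_words[of \<gamma> "[i]"] by simp

lemma reduced_flip:
  assumes "reduced_expression S m \<gamma>" "has_braid m \<gamma> i"
  shows "reduced_expression S m (flip_braid i \<gamma>)"
proof -
  have "braid_move_at m {i, i + 1, i + 2} \<gamma> (flip_braid i \<gamma>)"
    using assms(2) by (auto simp: braid_move_at_iff)
  then obtain u v s t where *: "m s t = 3" "\<gamma> = u @ [s, t, s] @ v"
      "flip_braid i \<gamma> = u @ [t, s, t] @ v"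
    by (auto simp: braid_move_at_def)
  have S: "u \<in> lists S" "v \<in> lists S" "s \<in> S" "t \<in> S"
    using assms(1) * by (auto simp: reduced_expression_def)
  show ?thesis
    using word_equiv_context[OF word_equiv_braid[OF coxeter S(3,4) *(1)] S(1,2)] S assms(1) *
    by (intro reduced_expression_transfer[OF assms(1)]) auto
qed

lemma words_reduced:
  assumes "\<gamma> \<in> words"
  shows "reduced_expression S m \<gamma>"
proof -
  have "reduced_expression S m \<delta>" if "braid_walk m \<gamma> is \<delta>" "reduced_expression S m \<gamma>" for \<gamma> "is" \<delta>
    using that by (induction "is" arbitrary: \<gamma>) (auto intro: reduced_flip)
  then show ?thesis using assms reduced by (auto simp: words_iff)
qed

lemma words_nth_in: "\<gamma> \<in> words \<Longrightarrow> k < length \<gamma> \<Longrightarrow> \<gamma> ! k \<in> S"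
  using words_reduced by (auto simp: reduced_expression_def in_lists_conv_set)

lemma has_braid_flip:
  assumes "\<gamma> \<in> words" "has_braid m \<gamma> i"
  shows "has_braid m (flip_braid i \<gamma>) i"
  using assms words_nth_in[OF assms(1)]
  by (auto simp: has_braid_def nth_flip_braid weight_sym)

lemma walk_rev:
  assumes "\<gamma> \<in> words" "braid_walk m \<gamma> is \<delta>"
  shows "braid_walk m \<delta> (rev is) \<gamma>"
  using assms
proof (induction "is" arbitrary: \<gamma>)
  case (Cons i "is")
  then have "braid_walk m \<delta> (rev is) (flip_braid i \<gamma>)" by (simp add: flip_in_words)
  moreover have "braid_walk m (flip_braid i \<gamma>) [i] \<gamma>"
    using Cons.prems has_braid_flip flip_braid_involution by auto
  ultimately show ?case by (auto simp: braid_walk_append)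
qed simp

lemma words_connected:
  assumes "\<gamma> \<in> words" "\<delta> \<in> words"
  shows "\<exists>is. braid_walk m \<gamma> is \<delta>"
proof -
  obtain "is" js where *: "braid_walk m \<alpha> is \<gamma>" "braid_walk m \<alpha> js \<delta>"
    using assms by (auto simp: words_iff)
  have "\<alpha> \<in> words" by (simp add: braid_class_def braid_equivalent_def)
  then have "braid_walk m \<gamma> (rev is @ js) \<delta>"
    using walk_rev[OF _ *(1)] *(2) by (auto simp: braid_walk_append)
  then show ?thesis by blast
qed

lemma words_no_alternating_four:
  assumes "\<gamma> \<in> words" "has_braid m \<gamma> i" "has_braid m \<gamma> (i + 1)"
  shows False
proof -
  let ?s = "\<gamma> ! i" and ?t = "\<gamma> ! (i + 1)"
  have len: "i + 3 < length \<gamma>" using assms(3) by (simp add: has_braid_def)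
  have eq: "\<gamma> ! (i + 2) = ?s" "\<gamma> ! (i + 3) = ?t" and m3: "m ?s ?t = 3"
    using assms(2,3) by (auto simp: has_braid_def add.assoc eval_nat_numeral)
  have "\<gamma> = take i \<gamma> @ [?s, ?t, \<gamma> ! (i + 2), \<gamma> ! (i + 3)] @ drop (i + 4) \<gamma>"
    using len by (simp add: Cons_nth_drop_Suc eval_nat_numeral)
  then have "reduced_expression S m (take i \<gamma> @ [?s, ?t, ?s, ?t] @ drop (i + 4) \<gamma>)"
    using words_reduced[OF assms(1)] eq by simp
  from reduced_no_alternating_four[OF coxeter this] m3 show False by simp
qed

section \<open>Shadows of one class do not share two positions\<close>

text \<open>A shortest walk uses no shadow that crosses the border before the position \<open>i + 3\<close>, so its
  right part alone would produce a word with shadows at both \<open>i\<close> and \<open>i + 1\<close>, that is, a factor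
  \<open>stst\<close>. The induction on the length of the walk stands for the choice of a shortest walk between
  two words of the class with shadows that share two positions: any shadow used on the way is joined
  by a shorter walk to each of the two end words, hence is not one step away from \<open>i\<close> or \<open>j\<close>.\<close>

lemma walk_braids_not_adjacent:
  assumes "\<gamma> \<in> words" "braid_walk m \<gamma> is \<delta>" "has_braid m \<gamma> i" "has_braid m \<delta> j"
  shows "j \<noteq> i + 1 \<and> i \<noteq> j + 1"
  using assms
proof (induction "is" arbitrary: \<gamma> \<delta> i j rule: length_induct)
  case (1 "is")
  have step: False
    if \<gamma>: "\<gamma> \<in> words" and walk: "braid_walk m \<gamma> ks \<delta>" and len: "length ks = length is"
      and braids: "has_braid m \<gamma> i" "has_braid m \<delta> (i + 1)" for \<gamma> \<delta> ks i
  proof -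
    have away: "k + 2 \<le> i \<or> i + 3 \<le> k" if "k \<in> set ks" for k
    proof -
      obtain xs ys where ks: "ks = xs @ k # ys" using \<open>k \<in> set ks\<close> by (meson split_list)
      then obtain \<epsilon> where \<epsilon>: "braid_walk m \<gamma> xs \<epsilon>" "has_braid m \<epsilon> k"
          "braid_walk m (flip_braid k \<epsilon>) ys \<delta>"
        using walk by (auto simp: braid_walk_append)
      have "\<epsilon> \<in> words" using walk_in_words[OF \<gamma> \<epsilon>(1)] .
      note flip = flip_in_words[OF this \<epsilon>(2)] has_braid_flip[OF this \<epsilon>(2)]
      have short: "length xs < length is" "length ys < length is" using ks len by auto
      have "k \<noteq> i + 1 \<and> i \<noteq> k + 1" using 1(1) short(1) \<gamma> \<epsilon>(1,2) braids(1) by blast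
      moreover have "i + 1 \<noteq> k + 1 \<and> k \<noteq> i + 1 + 1"
        using 1(1) short(2) flip \<epsilon>(3) braids(2) by blast
      ultimately show ?thesis by auto
    qed
    have "\<And>k. k \<in> set ks \<Longrightarrow> k + 2 < i + 3 \<or> i + 3 \<le> k" using away by fastforce
    from braid_walk_right_part[OF walk this, of \<gamma>] obtain \<delta>' js where
      \<delta>': "braid_walk m \<gamma> js \<delta>'" "\<And>k. k < i + 3 \<Longrightarrow> \<delta>' ! k = \<gamma> ! k"
        "\<And>k. i + 3 \<le> k \<Longrightarrow> \<delta>' ! k = \<delta> ! k"
      by auto
    have same: "\<delta> ! k = \<gamma> ! k" if "k = i + 1 \<or> k = i + 2" for k
      by (rule braid_walk_nth_untouched[OF walk]) (use away that in fastforce)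
    have lens: "length \<delta>' = length \<gamma>" "length \<delta> = length \<gamma>"
      using braid_walk_length[OF \<delta>'(1)] braid_walk_length[OF walk] by auto
    have "has_braid m \<delta>' i"
      using \<delta>'(2) lens by (intro has_braid_cong[OF braids(1)]) auto
    moreover have "has_braid m \<delta>' (i + 1)"
      using \<delta>'(2)[of "i + 1"] \<delta>'(2)[of "i + 2"] \<delta>'(3)[of "i + 3"] lens
        same[of "i + 1"] same[of "i + 2"]
      by (intro has_braid_cong[OF braids(2)]) (auto simp: eval_nat_numeral)
    ultimately show False
      using words_no_alternating_four walk_in_words[OF \<gamma> \<delta>'(1)] by blast
  qed
  have "\<delta> \<in> words" "braid_walk m \<delta> (rev is) \<gamma>"
    using 1(2,3) walk_in_words walk_rev by auto
  then show ?case using step[of \<gamma> "is" \<delta> i] step[of \<delta> "rev is" \<gamma> j] 1(2-5) by auto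
qed

definition class_braids :: "nat set" where
  "class_braids = {i. \<exists>\<gamma>\<in>words. has_braid m \<gamma> i}"

lemma class_braids_not_adjacent:
  assumes "i \<in> class_braids" "j \<in> class_braids"
  shows "j \<noteq> i + 1"
  using assms words_connected walk_braids_not_adjacent unfolding class_braids_def by blast

lemma shadow_in_class_iff: "{i, i + 1, i + 2} \<in> class_shadows m \<alpha> \<longleftrightarrow> i \<in> class_braids"
  using shadow_inject by (auto simp: class_shadows_def class_braids_def braid_shadows_eq)

lemma walk_class_braids:
  assumes "\<gamma> \<in> words" "braid_walk m \<gamma> is \<delta>"
  shows "set is \<subseteq> class_braids"
  using assms
proof (induction "is" arbitrary: \<gamma>)
  case (Cons i "is")
  then show ?case using flip_in_words[of \<gamma> i] unfolding class_braids_def by auto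
qed simp

lemma walk_nth_centre_untouched:
  assumes "\<gamma> \<in> words" "braid_walk m \<gamma> is \<delta>" "i \<in> class_braids" "i \<notin> set is"
  shows "\<delta> ! (i + 1) = \<gamma> ! (i + 1)"
proof (rule braid_walk_nth_untouched[OF assms(2)])
  fix j assume j: "j \<in> set is"
  then have "j \<in> class_braids" using walk_class_braids[OF assms(1,2)] by blast
  then have "j \<noteq> i + 1" "i \<noteq> j + 1" using class_braids_not_adjacent assms(3) by blast+
  then show "i + 1 \<noteq> j \<and> i + 1 \<noteq> j + 1 \<and> i + 1 \<noteq> j + 2" using j assms(4) by auto
qed

text \<open>The letter at the centre \<open>i + 1\<close> of a shadow of the class changes only in the moves at \<open>i\<close>, and
  each of them does change it. So if every shadow is used at most once, comparing the two end words at
  the centres tells which shadows were used.\<close>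

lemma distinct_walk_set:
  assumes "\<gamma> \<in> words" "braid_walk m \<gamma> is \<delta>" "distinct is"
  shows "set is = {i \<in> class_braids. \<gamma> ! (i + 1) \<noteq> \<delta> ! (i + 1)}"
proof -
  have "\<gamma> ! (i + 1) \<noteq> \<delta> ! (i + 1)" if i: "i \<in> set is" for i
  proof -
    obtain xs ys where split: "is = xs @ i # ys" using i by (meson split_list)
    then obtain \<epsilon> where \<epsilon>: "braid_walk m \<gamma> xs \<epsilon>" "has_braid m \<epsilon> i"
        "braid_walk m (flip_braid i \<epsilon>) ys \<delta>"
      using assms(2) by (auto simp: braid_walk_append)
    have w: "\<epsilon> \<in> words" using walk_in_words[OF assms(1) \<epsilon>(1)] .
    have C: "i \<in> class_braids" using w \<epsilon>(2) by (auto simp: class_braids_def)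
    have "\<epsilon> ! (i + 1) = \<gamma> ! (i + 1)"
      using walk_nth_centre_untouched[OF assms(1) \<epsilon>(1) C] assms(3) split by auto
    moreover have "\<delta> ! (i + 1) = flip_braid i \<epsilon> ! (i + 1)"
      using walk_nth_centre_untouched[OF flip_in_words[OF w \<epsilon>(2)] \<epsilon>(3) C] assms(3) split by auto
    moreover have "flip_braid i \<epsilon> ! (i + 1) \<noteq> \<epsilon> ! (i + 1)"
    proof -
      have len: "i + 2 < length \<epsilon>" and "m (\<epsilon> ! i) (\<epsilon> ! (i + 1)) = 3"
        using \<epsilon>(2) by (auto simp: has_braid_def)
      then have "\<epsilon> ! i \<noteq> \<epsilon> ! (i + 1)"
        using weight_three_neq words_nth_in[OF w] by simp
      then show ?thesis using len by (simp add: nth_flip_braid)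
    qed
    ultimately show ?thesis by simp
  qed
  moreover have "i \<in> set is" if "i \<in> class_braids" "\<gamma> ! (i + 1) \<noteq> \<delta> ! (i + 1)" for i
    using walk_nth_centre_untouched[OF assms(1,2) that(1)] that(2) by auto
  ultimately show ?thesis
    using walk_class_braids[OF assms(1,2)] by blast
qed

section \<open>Repeated moves\<close>

lemma weight_three_edge:
  "s \<in> S \<Longrightarrow> t \<in> S \<Longrightarrow> m s t = 3 \<Longrightarrow> coxeter_edge S m s t"
  using weight_three_neq by (auto simp: coxeter_edge_def)

text \<open>The position \<open>k\<close> is the end shared by the shadows \<open>i\<close> and \<open>j\<close>. Between the two moves in the
  shadow \<open>i\<close>, the single move in the shadow \<open>j\<close> would exchange the letter \<open>t\<close> at \<open>k\<close> for a letter \<open>u\<close>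
  that is joined to \<open>t\<close> and, since the shadow \<open>i\<close> reappears around the old centre \<open>s\<close>, also to \<open>s\<close>. As \<open>s\<close>
  and \<open>t\<close> are joined too, this is a three-cycle.\<close>

lemma no_single_neighbour_move:
  assumes "type_Lambda S m" "\<gamma> \<in> words" "has_braid m \<gamma> i"
    and walk: "braid_walk m (flip_braid i \<gamma>) ys \<delta>" "has_braid m \<delta> i"
    and ys: "distinct ys" "i \<notin> set ys" "j \<in> set ys"
    and k: "k = i \<and> k = j + 2 \<or> k = i + 2 \<and> k = j"
  shows False
proof -
  obtain as bs where split: "ys = as @ j # bs" using ys by (meson split_list)
  then obtain \<epsilon> where \<epsilon>: "braid_walk m (flip_braid i \<gamma>) as \<epsilon>" "has_braid m \<epsilon> j"
      "braid_walk m (flip_braid j \<epsilon>) bs \<delta>"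
    using walk(1) by (auto simp: braid_walk_append)
  have flip: "flip_braid i \<gamma> \<in> words" using flip_in_words assms(2,3) .
  have words: "\<epsilon> \<in> words" "\<delta> \<in> words"
    using walk_in_words[OF flip] \<epsilon>(1) walk(1) by auto
  have i: "i \<in> class_braids" using assms(2,3) by (auto simp: class_braids_def)
  have untouched: "k \<noteq> l \<and> k \<noteq> l + 1 \<and> k \<noteq> l + 2" if "l \<in> set as \<union> set bs" for l
  proof -
    have "l \<in> class_braids" using walk_class_braids[OF flip walk(1)] that split by auto
    then have "l \<noteq> i + 1" "i \<noteq> l + 1" using class_braids_not_adjacent i by blast+
    moreover have "l \<noteq> i" "l \<noteq> j" using that ys split by auto
    ultimately show ?thesis using k by auto
  qed
  let ?s = "\<gamma> ! i" and ?t = "\<gamma> ! (i + 1)" and ?u = "\<epsilon> ! (j + 1)"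
  have bounds: "i + 2 < length \<gamma>" "j + 2 < length \<epsilon>" using assms(3) \<epsilon>(2) by (auto simp: has_braid_def)
  have "\<epsilon> ! k = flip_braid i \<gamma> ! k"
    using braid_walk_nth_untouched[OF \<epsilon>(1)] untouched by blast
  then have t: "\<epsilon> ! k = ?t" using k bounds by (auto simp: nth_flip_braid)
  have "\<delta> ! k = flip_braid j \<epsilon> ! k"
    using braid_walk_nth_untouched[OF \<epsilon>(3)] untouched by blast
  then have u: "\<delta> ! k = ?u" using k bounds by (auto simp: nth_flip_braid)
  have "\<delta> ! (i + 1) = flip_braid i \<gamma> ! (i + 1)"
    using walk_nth_centre_untouched[OF flip walk(1) i ys(2)] .
  then have s: "\<delta> ! (i + 1) = ?s" using bounds by (simp add: nth_flip_braid)
  have S: "?s \<in> S" "?t \<in> S" "?u \<in> S"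
    using words_nth_in assms(2) words bounds by auto
  have "m ?s ?t = 3" using assms(3) unfolding has_braid_def by blast
  moreover have "m ?t ?u = 3" using \<epsilon>(2) k t unfolding has_braid_def by metis
  moreover have "m ?u ?s = 3" using walk(2) k s u unfolding has_braid_def by metis
  ultimately show False
    using assms(1) S weight_three_edge unfolding type_Lambda_def by blast
qed

lemma repeated_braid_shortens:
  assumes "type_Lambda S m" "\<gamma> \<in> words" "braid_walk m \<gamma> is \<delta>" "\<not> distinct is"
  shows "\<exists>js. braid_walk m \<gamma> js \<delta> \<and> length js < length is"
proof -
  \<comment> \<open>Cutting at the first entry that repeats an earlier one makes the part in between distinct.\<close>
  obtain pre i zs where pre: "i \<in> set pre" "distinct pre" "is = pre @ i # zs"
    using assms(4) not_distinct_conv_prefix by metis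
  then obtain xs ys where "pre = xs @ i # ys" by (meson split_list)
  with pre have split: "is = xs @ i # ys @ i # zs" and ys: "distinct ys" "i \<notin> set ys" by auto
  then obtain \<gamma>1 \<gamma>2 where walks: "braid_walk m \<gamma> xs \<gamma>1" "has_braid m \<gamma>1 i"
      "braid_walk m (flip_braid i \<gamma>1) ys \<gamma>2" "has_braid m \<gamma>2 i" "braid_walk m (flip_braid i \<gamma>2) zs \<delta>"
    using assms(3) by (auto simp: braid_walk_append)
  have w: "\<gamma>1 \<in> words" using walk_in_words[OF assms(2) walks(1)] .
  have "j + 2 < i \<or> i + 2 < j" if j: "j \<in> set ys" for j
  proof -
    have "j \<in> class_braids" "i \<in> class_braids"
      using walk_class_braids[OF flip_in_words[OF w walks(2)] walks(3)] w walks(2) j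
      by (auto simp: class_braids_def)
    then have "j \<noteq> i + 1" "i \<noteq> j + 1" using class_braids_not_adjacent by blast+
    moreover have "j \<noteq> i" using j ys by blast
    moreover have "i \<noteq> j + 2" "j \<noteq> i + 2"
      using no_single_neighbour_move[OF assms(1) w walks(2-4) ys j] by blast+
    ultimately show ?thesis by arith
  qed
  then have "braid_walk m (flip_braid i (flip_braid i \<gamma>1)) ys (flip_braid i \<gamma>2)"
    using walks(2) by (intro braid_walk_flip_disjoint[OF walks(3)]) (auto simp: has_braid_def)
  then have "braid_walk m \<gamma>1 ys (flip_braid i \<gamma>2)"
    using flip_braid_involution[OF walks(2)] by simp
  then have "braid_walk m \<gamma> (xs @ ys @ zs) \<delta>"
    using walks by (auto simp: braid_walk_append)
  then show ?thesis using split by (intro exI[of _ "xs @ ys @ zs"]) simp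
qed

section \<open>Minimal braid sequences\<close>

definition number :: "nat \<Rightarrow> nat" where
  "number i = shadow_number m \<alpha> {i, i + 1, i + 2}"

lemma braid_path_iff_walk:
  assumes "\<gamma> \<in> words"
  shows "braid_path m \<alpha> \<gamma> js \<delta> \<longleftrightarrow> (\<exists>is. braid_walk m \<gamma> is \<delta> \<and> js = map number is)"
  using assms
proof (induction js arbitrary: \<gamma>)
  case Nil
  show ?case by auto
next
  case (Cons j js)
  have "braid_path m \<alpha> \<gamma> (j # js) \<delta> \<longleftrightarrow>
      (\<exists>i. has_braid m \<gamma> i \<and> number i = j \<and> braid_path m \<alpha> (flip_braid i \<gamma>) js \<delta>)"
  proof
    assume "braid_path m \<alpha> \<gamma> (j # js) \<delta>"
    then show "\<exists>i. has_braid m \<gamma> i \<and> number i = j \<and> braid_path m \<alpha> (flip_braid i \<gamma>) js \<delta>"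
      unfolding braid_path.simps braid_move_at_iff number_def by blast
  next
    assume "\<exists>i. has_braid m \<gamma> i \<and> number i = j \<and> braid_path m \<alpha> (flip_braid i \<gamma>) js \<delta>"
    then obtain i where "has_braid m \<gamma> i" "number i = j" "braid_path m \<alpha> (flip_braid i \<gamma>) js \<delta>"
      by blast
    moreover from this have "{i, i + 1, i + 2} \<in> class_shadows m \<alpha>"
      using Cons.prems shadow_in_class_iff class_braids_def by blast
    ultimately show "braid_path m \<alpha> \<gamma> (j # js) \<delta>"
      unfolding braid_path.simps braid_move_at_iff number_def by blast
  qed
  also have "\<dots> \<longleftrightarrow> (\<exists>i. has_braid m \<gamma> i \<and> number i = j \<and>
      (\<exists>is. braid_walk m (flip_braid i \<gamma>) is \<delta> \<and> js = map number is))"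
    using Cons.IH flip_in_words[OF Cons.prems] by blast
  also have "\<dots> \<longleftrightarrow> (\<exists>is. braid_walk m \<gamma> is \<delta> \<and> j # js = map number is)"
  proof
    assume "\<exists>i. has_braid m \<gamma> i \<and> number i = j \<and>
      (\<exists>is. braid_walk m (flip_braid i \<gamma>) is \<delta> \<and> js = map number is)"
    then obtain i "is" where "has_braid m \<gamma> i" "number i = j"
        "braid_walk m (flip_braid i \<gamma>) is \<delta>" "js = map number is"
      by blast
    then have "braid_walk m \<gamma> (i # is) \<delta> \<and> j # js = map number (i # is)"
      by simp
    then show "\<exists>is. braid_walk m \<gamma> is \<delta> \<and> j # js = map number is" by (rule exI)
  next
    assume "\<exists>is. braid_walk m \<gamma> is \<delta> \<and> j # js = map number is"
    then obtain "is" where walk: "braid_walk m \<gamma> is \<delta> \<and> j # js = map number is" ..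
    then obtain i ks where "is = i # ks" by (cases "is") auto
    with walk have "has_braid m \<gamma> i \<and> number i = j \<and> braid_walk m (flip_braid i \<gamma>) ks \<delta> \<and>
        js = map number ks"
      by simp
    then show "\<exists>i. has_braid m \<gamma> i \<and> number i = j \<and>
        (\<exists>is. braid_walk m (flip_braid i \<gamma>) is \<delta> \<and> js = map number is)"
      by (elim conjE) (intro exI conjI)
  qed
  finally show ?case .
qed

lemma minimal_braid_sequence_set:
  assumes "type_Lambda S m" "minimal_braid_sequence m \<alpha> js \<beta>"
  shows "set js = number ` {i \<in> class_braids. \<alpha> ! (i + 1) \<noteq> \<beta> ! (i + 1)}"
proof -
  have \<alpha>: "\<alpha> \<in> words" by (simp add: braid_class_def braid_equivalent_def)
  obtain "is" where "is": "braid_walk m \<alpha> is \<beta>" "js = map number is"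
    using assms(2) braid_path_iff_walk[OF \<alpha>]
    unfolding minimal_braid_sequence_def braid_sequence_def by blast
  have "length is \<le> length ks" if "braid_walk m \<alpha> ks \<beta>" for ks
  proof -
    have "braid_sequence m \<alpha> (map number ks) \<beta>"
      using that braid_path_iff_walk[OF \<alpha>] unfolding braid_sequence_def by blast
    then have "length js \<le> length (map number ks)"
      using assms(2) unfolding minimal_braid_sequence_def by blast
    then show ?thesis using "is"(2) by simp
  qed
  then have "distinct is"
    using repeated_braid_shortens[OF assms(1) \<alpha> "is"(1)] by (meson not_le)
  then show ?thesis using distinct_walk_set[OF \<alpha> "is"(1)] "is"(2) by auto
qed

end

theorem proposition5p2:
  fixes S :: "'a set" and m :: "'a \<Rightarrow> 'a \<Rightarrow> enat"
    and \<alpha> \<beta> :: "'a list" and js ls :: "nat list" and k :: nat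
  assumes "coxeter_system S m" and "type_Lambda S m"
    and "reduced_expression S m \<alpha>" and "reduced_expression S m \<beta>"
    and "braid_equivalent m \<alpha> \<beta>"
    and "1 \<le> braid_dim m \<alpha>" and "1 \<le> braid_dim m \<beta>"
    and "minimal_braid_sequence m \<alpha> js \<beta>" and "length js = k"
    and "minimal_braid_sequence m \<alpha> ls \<beta>" and "length ls = k"
  shows "set js = set ls"
proof -
  interpret reduced_braid_class S m \<alpha>
    using assms by unfold_locales
  show ?thesis
    using minimal_braid_sequence_set assms(2,8,10) by simp
qed

end
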